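(* Let $A\in\mathbb{C}^{n\times n}$ and let $k$ be an integer with $0\leq k \leq n$. Then $A\in\mathcal{H}_k$ if and only if the Hermitian matrix $S(A):=\frac{1}{2i}(A-A^* )$ has at most $k$ positive eigenvalues and at most $k$ negative eigenvalues.
   Context: $\mathcal{H}_k$ is the set of Hermitian-plus-rank-$k$ matrices: $A\in\mathbb{C}^{n\times n}$ belongs to $\mathcal{H}_k$ if and only if there exist a Hermitian matrix $H\in\mathbb{C}^{n\times n}$ and matrices $G,B\in\mathbb{C}^{n\times k}$ such that $A = H + GB^*$. Eigenvalues are counted with multiplicity; positive and negative mean strictly so. *)

theory Defs
  imports
    "Jordan_Normal_Form.Schur_Decomposition"
    "HOL-Computational_Algebra.Polynomial"
begin

definition hermitian_mat :: "complex mat \<Rightarrow> bool" where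
  "hermitian_mat H \<longleftrightarrow> mat_adjoint H = H"

definition hermitian_plus_rank :: "nat \<Rightarrow> nat \<Rightarrow> complex mat set" where
  "hermitian_plus_rank n k =
     {A. \<exists>H \<in> carrier_mat n n. \<exists>G \<in> carrier_mat n k. \<exists>B \<in> carrier_mat n k.
           hermitian_mat H \<and> A = H + G * mat_adjoint B}"

definition skew_part :: "complex mat \<Rightarrow> complex mat" where
  "skew_part A = (1 / (2 * \<i>)) \<cdot>\<^sub>m (A - mat_adjoint A)"

definition eigenvalue_mset :: "complex mat \<Rightarrow> complex multiset" where
  "eigenvalue_mset M = proots (char_poly M)"

definition num_pos_eigenvalues :: "complex mat \<Rightarrow> nat" where
  "num_pos_eigenvalues M = size {# x \<in># eigenvalue_mset M. x \<in> \<real> \<and> 0 < Re x #}"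

definition num_neg_eigenvalues :: "complex mat \<Rightarrow> nat" where
  "num_neg_eigenvalues M = size {# x \<in># eigenvalue_mset M. x \<in> \<real> \<and> Re x < 0 #}"

lemma mat_adjoint_carrier: "A \<in> carrier_mat m n \<Longrightarrow> mat_adjoint A \<in> carrier_mat n m"
  unfolding mat_adjoint_def by auto

lemma mat_adjoint_index:
  assumes "i < dim_col A" "j < dim_row A"
  shows "mat_adjoint A $$ (i, j) = cnj (A $$ (j, i))"
  using assms unfolding mat_adjoint_def by (simp add: mat_of_rows_index)

lemma hermitian_skew_part:
  assumes "A \<in> carrier_mat n n"
  shows "hermitian_mat (skew_part A)"
proof -
  have c: "mat_adjoint A \<in> carrier_mat n n"
    using assms by (rule mat_adjoint_carrier)
  have S: "skew_part A \<in> carrier_mat n n"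
    unfolding skew_part_def using assms c by auto
  have c': "mat_adjoint (skew_part A) \<in> carrier_mat n n"
    using S by (rule mat_adjoint_carrier)
  have e: "skew_part A $$ (i, j) = (A $$ (i, j) - cnj (A $$ (j, i))) / (2 * \<i>)"
    if "i < n" "j < n" for i j
    using that assms c by (simp add: skew_part_def mat_adjoint_index)
  show ?thesis
    unfolding hermitian_mat_def
  proof (rule eq_matI)
    fix i j assume ij: "i < dim_row (skew_part A)" "j < dim_col (skew_part A)"
    then have "i < n" "j < n" using S by auto
    then show "mat_adjoint (skew_part A) $$ (i, j) = skew_part A $$ (i, j)"
      using S by (simp add: mat_adjoint_index e field_simps)
  qed (use S c' in auto)
qed

end

theory Submission
  imports Defs
begin

text \<open>
  Write \<open>q(v) = v\<^sup>* S(A) v\<close> for the Hermitian form of the skew part; \<open>q(v)\<close> is the imaginary part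
  of \<open>v\<^sup>* A v\<close>.

  If \<open>A = H + G B\<^sup>*\<close> with \<open>H\<close> Hermitian, then \<open>A\<close> and \<open>H\<close> agree on the kernel of \<open>B\<^sup>*\<close>, so
  \<open>q\<close> vanishes there. This kernel has codimension at most \<open>k\<close>, hence it contains a nonzero vector of
  every subspace of dimension greater than \<open>k\<close>, while it meets a subspace on which \<open>q\<close> is definite only in
  \<open>0\<close>. The span of the eigenvectors of \<open>S(A)\<close> for the positive eigenvalues is such a subspace, and so
  is the span for the negative ones; this is \<open>card_definite_directions_le\<close>.

  Conversely, the spectral theorem groups the eigenvalues by sign and gives
  \<open>S(A) = X X\<^sup>* - Y Y\<^sup>*\<close>, where \<open>X\<close> and \<open>Y\<close> have as many nonzero columns as there are positive and
  negative eigenvalues, that is, at most \<open>k\<close>. What makes \<open>k\<close> columns enough for both signs at once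
  is the identity
  \<open>\<i> (X + Y) (X - Y)\<^sup>* = \<i> (X X\<^sup>* - Y Y\<^sup>*) + \<i> (Y X\<^sup>* - X Y\<^sup>*)\<close>,
  whose last summand is Hermitian: subtracting from \<open>A\<close> the product on the left, which has rank at most
  \<open>k\<close>, leaves a Hermitian matrix (\<open>hermitian_plus_rank_if_skew_part_difference\<close>).

  Both directions use the spectral theorem for Hermitian matrices in a form that ties the diagonal to the
  characteristic polynomial, so that multiplicities are counted correctly
  (\<open>hermitian_spectral_theorem\<close>, \<open>num_eigenvalues_eq_card\<close>).
\<close>

section \<open>Adjoints\<close>

lemma mat_adjoint_dim [simp]:
  "dim_row (mat_adjoint M) = dim_col M" "dim_col (mat_adjoint M) = dim_row M"
  using mat_adjoint_carrier[of M "dim_row M" "dim_col M"] by auto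

lemma mat_adjoint_mult:
  fixes M N :: "complex mat"
  assumes "M \<in> carrier_mat n m" "N \<in> carrier_mat m l"
  shows "mat_adjoint (M * N) = mat_adjoint N * mat_adjoint M"
  by (rule eq_matI)
    (use assms in \<open>auto simp: mat_adjoint_index scalar_prod_def mult.commute intro!: sum.cong\<close>)

lemma mat_adjoint_adjoint:
  fixes M :: "complex mat"
  shows "mat_adjoint (mat_adjoint M) = M"
  by (rule eq_matI) (auto simp: mat_adjoint_index)

lemma mat_adjoint_one: "mat_adjoint (1\<^sub>m n :: complex mat) = 1\<^sub>m n"
  by (rule eq_matI) (auto simp: mat_adjoint_index)

lemma mat_adjoint_four_block_diag:
  fixes M N :: "complex mat"
  assumes "M \<in> carrier_mat m m" "N \<in> carrier_mat n n"
  shows "mat_adjoint (four_block_mat M (0\<^sub>m m n) (0\<^sub>m n m) N) =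
    four_block_mat (mat_adjoint M) (0\<^sub>m m n) (0\<^sub>m n m) (mat_adjoint N)"
  by (rule eq_matI) (use assms in \<open>auto simp: mat_adjoint_index\<close>)

lemma cscalar_prod_mult_adjoint:
  fixes M :: "complex mat"
  assumes "M \<in> carrier_mat n m" "x \<in> carrier_vec m" "y \<in> carrier_vec n"
  shows "(M *\<^sub>v x) \<bullet>c y = x \<bullet>c (mat_adjoint M *\<^sub>v y)"
proof -
  have "(M *\<^sub>v x) \<bullet>c y = (\<Sum>i<n. \<Sum>j<m. M $$ (i,j) * x $ j * cnj (y $ i))"
    using assms by (auto simp: scalar_prod_def sum_distrib_right atLeast0LessThan intro!: sum.cong)
  also have "\<dots> = (\<Sum>j<m. \<Sum>i<n. M $$ (i,j) * x $ j * cnj (y $ i))"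
    by (rule sum.swap)
  also have "\<dots> = x \<bullet>c (mat_adjoint M *\<^sub>v y)"
    using assms
    by (auto simp: scalar_prod_def sum_distrib_left mat_adjoint_index atLeast0LessThan ac_simps
        intro!: sum.cong)
  finally show ?thesis .
qed

lemma cscalar_prod_self:
  fixes v :: "complex vec"
  shows "v \<bullet>c v = of_real (\<Sum>i<dim_vec v. (cmod (v $ i))\<^sup>2)"
  by (simp add: scalar_prod_def complex_norm_square atLeast0LessThan del: of_real_power)

lemma hermitian_congruence:
  assumes S: "S \<in> carrier_mat n n" and herm: "hermitian_mat S" and W: "W \<in> carrier_mat n m"
  shows "hermitian_mat (mat_adjoint W * S * W)"
proof -
  have W': "mat_adjoint W \<in> carrier_mat m n" using W by (rule mat_adjoint_carrier)
  have "mat_adjoint (mat_adjoint W * S * W) = mat_adjoint W * (mat_adjoint S * W)"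
    unfolding mat_adjoint_mult[OF mult_carrier_mat[OF W' S] W] mat_adjoint_mult[OF W' S]
    by (simp add: mat_adjoint_adjoint)
  then show ?thesis
    using herm W W' S unfolding hermitian_mat_def by (simp add: assoc_mult_mat)
qed

section \<open>The spectral theorem\<close>

text \<open>Gram-Schmidt on a basis that starts with \<open>v\<close> yields orthogonal columns of which the first is
  still \<open>v\<close>; normalising the columns makes the matrix unitary.\<close>

lemma unitary_completion:
  fixes v :: "complex vec"
  assumes v: "v \<in> carrier_vec n" and v0: "v \<noteq> 0\<^sub>v n"
  shows "\<exists>W\<in>carrier_mat n n. mat_adjoint W * W = 1\<^sub>m n \<and> (\<exists>c. col W 0 = c \<cdot>\<^sub>v v)"
proof -
  interpret cof_vec_space n "TYPE(complex)" .
  define b where "b = basis_completion v"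
  note b = basis_completion[OF v v0, folded b_def]
  define ws where "ws = gram_schmidt n b"
  note ws = gram_schmidt_result[OF b(2) b(4) b(5) ws_def]
  have n: "n > 0" using v v0 by (cases n) auto
  have hd: "ws ! 0 = v"
  proof -
    obtain vs where "b = v # vs" using b(6,7) n by (cases b) auto
    then have "hd ws = v" using v ws_def by simp
    then show ?thesis using ws(4) b(6) n by (cases ws) auto
  qed
  have len: "length ws = n" using ws(4) b(6) by simp
  have wc: "ws ! j \<in> carrier_vec n" if "j < n" for j using ws(3) len that by auto
  \<comment> \<open>the Euclidean norm of the \<open>j\<close>-th orthogonal vector\<close>
  define r where "r j = sqrt (\<Sum>i<n. (cmod (ws ! j $ i))\<^sup>2)" for j
  have rr: "ws ! j \<bullet>c ws ! j = of_real (r j * r j)" if "j < n" for j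
    using wc[OF that] unfolding cscalar_prod_self r_def by (simp add: sum_nonneg)
  have r0: "r j \<noteq> 0" if "j < n" for j
    using corthogonalD[OF ws(2), of j j] rr[OF that] that len by auto
  define W where "W = mat n n (\<lambda>(i,j). ws ! j $ i / of_real (r j))"
  have W: "W \<in> carrier_mat n n" unfolding W_def by simp
  have "mat_adjoint W * W = 1\<^sub>m n"
  proof (rule eq_matI)
    fix a b assume ab: "a < dim_row (1\<^sub>m n :: complex mat)" "b < dim_col (1\<^sub>m n :: complex mat)"
    have "(mat_adjoint W * W) $$ (a,b) = (\<Sum>i<n. cnj (W $$ (i,a)) * W $$ (i,b))"
      using ab W by (auto simp: scalar_prod_def mat_adjoint_index atLeast0LessThan)
    also have "\<dots> = (\<Sum>i<n. ws ! b $ i * cnj (ws ! a $ i) / (of_real (r a) * of_real (r b)))"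
      using ab by (auto simp: W_def intro!: sum.cong)
    also have "\<dots> = (ws ! b \<bullet>c ws ! a) / (of_real (r a) * of_real (r b))"
      using ab wc[of a] wc[of b]
      by (auto simp: scalar_prod_def atLeast0LessThan sum_divide_distrib)
    also have "\<dots> = (if a = b then 1 else 0)"
      using corthogonalD[OF ws(2), of b a] ab len rr[of a] r0[of a] by auto
    finally show "(mat_adjoint W * W) $$ (a,b) = 1\<^sub>m n $$ (a,b)" using ab by simp
  qed (use W in auto)
  moreover have "col W 0 = (1 / of_real (r 0)) \<cdot>\<^sub>v v"
    by (rule eq_vecI) (use n v hd in \<open>auto simp: W_def\<close>)
  ultimately show ?thesis using W by blast
qed

text \<open>The inductive step of the spectral theorem: in an orthonormal basis that starts with an eigenvector, the
  first column of the matrix is a multiple of the first unit vector, and symmetry forces the same on the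
  first row.\<close>

lemma hermitian_deflation:
  fixes S :: "complex mat"
  assumes S: "S \<in> carrier_mat (Suc m) (Suc m)" and herm: "hermitian_mat S"
    and ev: "poly (char_poly S) e = 0"
  shows "\<exists>W\<in>carrier_mat (Suc m) (Suc m). \<exists>T\<in>carrier_mat m m.
    mat_adjoint W * W = 1\<^sub>m (Suc m) \<and> hermitian_mat T \<and>
    mat_adjoint W * S * W = four_block_mat (mat 1 1 (\<lambda>_. e)) (0\<^sub>m 1 m) (0\<^sub>m m 1) T"
proof -
  let ?n = "Suc m"
  obtain v where v: "v \<in> carrier_vec ?n" "v \<noteq> 0\<^sub>v ?n" "S *\<^sub>v v = e \<cdot>\<^sub>v v"
    using ev S unfolding eigenvalue_root_char_poly[OF S, symmetric] eigenvalue_def eigenvector_def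
    by auto
  obtain W c where W: "W \<in> carrier_mat ?n ?n" and WW: "mat_adjoint W * W = 1\<^sub>m ?n"
    and c: "col W 0 = c \<cdot>\<^sub>v v"
    using unitary_completion[OF v(1,2)] by blast
  have W': "mat_adjoint W \<in> carrier_mat ?n ?n" using W by (rule mat_adjoint_carrier)
  define M where "M = mat_adjoint W * S * W"
  have M: "M \<in> carrier_mat ?n ?n" unfolding M_def using W W' S by auto
  have Mh: "mat_adjoint M = M"
    using hermitian_congruence[OF S herm W] unfolding M_def hermitian_mat_def .
  have sym: "M $$ (i,j) = cnj (M $$ (j,i))" if "i < ?n" "j < ?n" for i j
    using mat_adjoint_index[of i M j] M that unfolding Mh by auto
  have "col M 0 = mat_adjoint W *\<^sub>v (S *\<^sub>v col W 0)"
    unfolding M_def assoc_mult_mat[OF W' S W]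
    by (simp add: col_mult2[OF W' mult_carrier_mat[OF S W]] col_mult2[OF S W])
  also have "S *\<^sub>v col W 0 = e \<cdot>\<^sub>v col W 0"
    unfolding c using S v by (simp add: mult_mat_vec[of _ ?n ?n] smult_smult_assoc mult.commute)
  also have "mat_adjoint W *\<^sub>v (e \<cdot>\<^sub>v col W 0) = e \<cdot>\<^sub>v col (mat_adjoint W * W) 0"
    using W
    by (subst mult_mat_vec[OF W']) (auto simp: col_mult2[OF W' W] intro: col_carrier_vec)
  finally have col: "col M 0 = e \<cdot>\<^sub>v unit_vec ?n 0" unfolding WW by simp
  have M0: "M $$ (i,0) = (if i = 0 then e else 0)" if "i < ?n" for i
    using arg_cong[OF col, of "\<lambda>u. u $ i"] that M by auto
  define T where "T = mat m m (\<lambda>(i,j). M $$ (Suc i, Suc j))"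
  have T: "T \<in> carrier_mat m m" unfolding T_def by simp
  have "M = four_block_mat (mat 1 1 (\<lambda>_. e)) (0\<^sub>m 1 m) (0\<^sub>m m 1) T"
  proof (rule eq_matI)
    fix i j
    assume "i < dim_row (four_block_mat (mat 1 1 (\<lambda>_. e)) (0\<^sub>m 1 m) (0\<^sub>m m 1) T)"
      "j < dim_col (four_block_mat (mat 1 1 (\<lambda>_. e)) (0\<^sub>m 1 m) (0\<^sub>m m 1) T)"
    then have ij: "i < ?n" "j < ?n" by (auto simp: T_def)
    then show "M $$ (i,j) = four_block_mat (mat 1 1 (\<lambda>_. e)) (0\<^sub>m 1 m) (0\<^sub>m m 1) T $$ (i,j)"
      using M0[OF ij(1)] M0[OF ij(2)] sym[OF ij] by (cases i; cases j) (auto simp: T_def)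
  qed (use M T in auto)
  moreover have "hermitian_mat T"
    unfolding hermitian_mat_def
    by (rule eq_matI) (auto simp: T_def mat_adjoint_index sym[symmetric])
  ultimately show ?thesis using W WW T unfolding M_def by blast
qed

text \<open>The diagonal is the prescribed list of roots of the characteristic polynomial, in the
  prescribed order. Deflation at the head of the list divides the characteristic polynomial
  by its linear factor, so the induction runs over the list.\<close>

theorem hermitian_spectral_theorem:
  fixes S :: "complex mat"
  assumes "S \<in> carrier_mat n n" "hermitian_mat S" "char_poly S = (\<Prod>a\<leftarrow>es. [:- a, 1:])"
  shows "\<exists>U\<in>carrier_mat n n. mat_adjoint U * U = 1\<^sub>m n \<and>
    mat_adjoint U * S * U = mat_diag n (\<lambda>i. es ! i)"
  using assms
proof (induction es arbitrary: n S)
  case Nil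
  then have "n = 0" using degree_monic_char_poly[OF Nil(1)] by simp
  then show ?case using Nil(1)
    by (intro bexI[of _ "1\<^sub>m 0"]) (auto simp: mat_adjoint_one mat_diag_def)
next
  case (Cons e es)
  have "degree (char_poly S) = Suc (length es)"
    unfolding Cons.prems(3) using degree_linear_factors[of uminus "e # es"] by simp
  then have n: "n = Suc (length es)" using degree_monic_char_poly[OF Cons.prems(1)] by simp
  define m where "m = length es"
  note n = n[folded m_def]
  have S: "S \<in> carrier_mat (Suc m) (Suc m)" using Cons.prems(1) n by simp
  have "poly (char_poly S) e = 0" unfolding Cons.prems(3) by simp
  from hermitian_deflation[OF S Cons.prems(2) this]
  obtain W T where W: "W \<in> carrier_mat n n" and T: "T \<in> carrier_mat m m"
    and WW: "mat_adjoint W * W = 1\<^sub>m n" and hT: "hermitian_mat T"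
    and M: "mat_adjoint W * S * W = four_block_mat (mat 1 1 (\<lambda>_. e)) (0\<^sub>m 1 m) (0\<^sub>m m 1) T"
    unfolding n by blast
  let ?E = "mat 1 1 (\<lambda>_. e)"
  have W': "mat_adjoint W \<in> carrier_mat n n" using W by (rule mat_adjoint_carrier)
  have S: "S \<in> carrier_mat n n" by fact
  have WW': "W * mat_adjoint W = 1\<^sub>m n" by (rule mat_mult_left_right_inverse[OF W' W WW])
  have "similar_mat_wit (mat_adjoint W * S * W) S (mat_adjoint W) W"
    unfolding similar_mat_wit_def Let_def using W W' S WW WW' by auto
  then have "char_poly S = char_poly (mat_adjoint W * S * W)"
    using char_poly_similar unfolding similar_mat_def by metis
  also have "\<dots> = char_poly ?E * char_poly T"
    by (rule char_poly_0_block'[OF M])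
      (use T char_poly_factorized[OF T] char_poly_factorized[of ?E 1] in auto)
  also have "char_poly ?E = [:- e, 1:]"
    by (subst char_poly_upper_triangular[of _ 1]) (auto simp: diag_mat_def)
  finally have "[:- e, 1:] * char_poly T = [:- e, 1:] * (\<Prod>a\<leftarrow>es. [:- a, 1:])"
    unfolding Cons.prems(3) by (simp del: mult_pCons_left)
  then have cT: "char_poly T = (\<Prod>a\<leftarrow>es. [:- a, 1:])"
    by (subst (asm) mult_cancel_left) simp
  obtain V where V: "V \<in> carrier_mat m m" and VV: "mat_adjoint V * V = 1\<^sub>m m"
    and VT: "mat_adjoint V * T * V = mat_diag m (\<lambda>i. es ! i)"
    using Cons.IH[OF T hT cT] by blast
  have V': "mat_adjoint V \<in> carrier_mat m m" using V by (rule mat_adjoint_carrier)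
  define F where "F = four_block_mat (1\<^sub>m 1) (0\<^sub>m 1 m) (0\<^sub>m m 1) V"
  have F: "F \<in> carrier_mat n n"
    using four_block_carrier_mat[OF one_carrier_mat[of 1] V] unfolding F_def n by simp
  have F': "mat_adjoint F = four_block_mat (1\<^sub>m 1) (0\<^sub>m 1 m) (0\<^sub>m m 1) (mat_adjoint V)"
    unfolding F_def using mat_adjoint_four_block_diag[OF one_carrier_mat V]
    by (simp add: mat_adjoint_one)
  have Fc': "mat_adjoint F \<in> carrier_mat n n" using F by (rule mat_adjoint_carrier)
  have "mat_adjoint F * F = four_block_mat (1\<^sub>m 1) (0\<^sub>m 1 m) (0\<^sub>m m 1) (1\<^sub>m m)"
    unfolding F' unfolding F_def
    by (subst mult_four_block_mat[of _ 1 1 _ m _ m _ _ 1 _ m]) (use V V' VV in auto)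
  also have "\<dots> = 1\<^sub>m n" unfolding n by (rule eq_matI) auto
  finally have FF: "mat_adjoint F * F = 1\<^sub>m n" .
  have "mat_adjoint F * (mat_adjoint W * S * W) * F
      = four_block_mat ?E (0\<^sub>m 1 m) (0\<^sub>m m 1) (mat_diag m (\<lambda>i. es ! i))"
    unfolding M F' unfolding F_def
    using V V' T VT by (simp add: mult_four_block_mat[of _ 1 1 _ m _ m _ _ 1 _ m])
  also have "\<dots> = mat_diag n (\<lambda>i. (e # es) ! i)"
    unfolding n by (rule eq_matI) (auto simp: mat_diag_def nth_Cons split: nat.splits)
  finally have D: "mat_adjoint F * (mat_adjoint W * S * W) * F = mat_diag n (\<lambda>i. (e # es) ! i)" .
  have adj: "mat_adjoint (W * F) = mat_adjoint F * mat_adjoint W"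
    by (rule mat_adjoint_mult[OF W F])
  have "mat_adjoint (W * F) * (W * F) = mat_adjoint F * (mat_adjoint W * W) * F"
    unfolding adj using W W' F Fc' by (simp add: assoc_mult_mat[of _ n n _ n _ n])
  also have "\<dots> = 1\<^sub>m n" unfolding WW right_mult_one_mat[OF Fc'] by (rule FF)
  finally have 1: "mat_adjoint (W * F) * (W * F) = 1\<^sub>m n" .
  have 2: "mat_adjoint (W * F) * S * (W * F) = mat_diag n (\<lambda>i. (e # es) ! i)"
    unfolding adj D[symmetric] using W W' F Fc' S by (simp add: assoc_mult_mat[of _ n n _ n _ n])
  show ?case using 1 2 W F by (intro bexI[of _ "W * F"]) auto
qed

lemma hermitian_compression_diag_real:
  fixes S U :: "complex mat"
  assumes S: "S \<in> carrier_mat n n" and herm: "hermitian_mat S" and U: "U \<in> carrier_mat n n"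
    and diag: "mat_adjoint U * S * U = mat_diag n d" and i: "i < n"
  shows "d i \<in> \<real>"
proof -
  have "mat_adjoint (mat_diag n d) = mat_diag n d"
    using hermitian_congruence[OF S herm U] unfolding diag hermitian_mat_def .
  then have "cnj (mat_diag n d $$ (i,i)) = mat_diag n d $$ (i,i)"
    using mat_adjoint_index[of i "mat_diag n d" i] i by (simp add: mat_diag_def)
  then show ?thesis using i by (simp add: mat_diag_def Reals_cnj_iff)
qed

lemma spectral_entry:
  fixes S U :: "complex mat"
  assumes S: "S \<in> carrier_mat n n" and U: "U \<in> carrier_mat n n"
    and UU: "mat_adjoint U * U = 1\<^sub>m n" and diag: "mat_adjoint U * S * U = mat_diag n d"
    and ij: "i < n" "j < n"
  shows "S $$ (i,j) = (\<Sum>l<n. d l * U $$ (i,l) * cnj (U $$ (j,l)))"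
proof -
  have U': "mat_adjoint U \<in> carrier_mat n n" using U by (rule mat_adjoint_carrier)
  have UU': "U * mat_adjoint U = 1\<^sub>m n" by (rule mat_mult_left_right_inverse[OF U' U UU])
  have "S = (U * mat_adjoint U) * S * (U * mat_adjoint U)" using S by (simp add: UU')
  also have "\<dots> = U * (mat_adjoint U * S * U) * mat_adjoint U"
    using U U' S by (simp add: assoc_mult_mat[of _ n n _ n _ n])
  also have "\<dots> = mat n n (\<lambda>(i,j). U $$ (i,j) * d j) * mat_adjoint U"
    unfolding diag mat_diag_mult_right[OF U] ..
  also have "\<dots> $$ (i,j) = (\<Sum>l<n. d l * U $$ (i,l) * cnj (U $$ (j,l)))"
    using ij U by (auto simp: scalar_prod_def mat_adjoint_index atLeast0LessThan intro!: sum.cong)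
  finally show ?thesis .
qed

lemma num_eigenvalues_eq_card:
  assumes "char_poly S = (\<Prod>a\<leftarrow>es. [:- a, 1:])"
  shows "num_pos_eigenvalues S = card {i. i < length es \<and> es ! i \<in> \<real> \<and> 0 < Re (es ! i)}"
    and "num_neg_eigenvalues S = card {i. i < length es \<and> es ! i \<in> \<real> \<and> Re (es ! i) < 0}"
proof -
  have "proots (\<Prod>a\<leftarrow>es. [:- a, 1:]) = mset es" for es :: "complex list"
  proof (induction es)
    case (Cons e es)
    have "(\<Prod>a\<leftarrow>es. [:- a, 1:]) \<noteq> 0" by (auto simp: prod_list_zero_iff)
    then show ?case using Cons by (simp add: proots_mult del: mult_pCons_left)
  qed simp
  then have "eigenvalue_mset S = mset es" unfolding eigenvalue_mset_def assms by simp
  then have "size (filter_mset P (eigenvalue_mset S)) = card {i. i < length es \<and> P (es ! i)}" for P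
    by (simp flip: mset_filter add: length_filter_conv_card)
  then show "num_pos_eigenvalues S = card {i. i < length es \<and> es ! i \<in> \<real> \<and> 0 < Re (es ! i)}"
    and "num_neg_eigenvalues S = card {i. i < length es \<and> es ! i \<in> \<real> \<and> Re (es ! i) < 0}"
    unfolding num_pos_eigenvalues_def num_neg_eigenvalues_def by blast+
qed

section \<open>Isotropic subspaces bound the inertia\<close>

text \<open>Zero rows pad the system to a square one, whose determinant is then \<open>0\<close>.\<close>

lemma underdetermined_system:
  fixes C :: "complex mat"
  assumes C: "C \<in> carrier_mat k p" and "k < p"
  shows "\<exists>x\<in>carrier_vec p. x \<noteq> 0\<^sub>v p \<and> C *\<^sub>v x = 0\<^sub>v k"
proof -
  define M where "M = mat p p (\<lambda>(i,j). if i < k then C $$ (i,j) else 0)"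
  have M: "M \<in> carrier_mat p p" unfolding M_def by simp
  \<comment> \<open>row \<open>k\<close> is one of the padding rows\<close>
  have "transpose_mat M *\<^sub>v unit_vec p k = 0\<^sub>v p"
    by (rule eq_vecI) (use assms in \<open>auto simp: M_def\<close>)
  moreover have "unit_vec p k \<noteq> (0\<^sub>v p :: complex vec)"
    using \<open>k < p\<close> by (metis index_unit_vec(1) index_zero_vec(1) one_neq_zero)
  ultimately have "det (transpose_mat M) = 0"
    using det_0_iff_vec_prod_zero[of "transpose_mat M" p] M
    by (meson transpose_carrier_mat unit_vec_carrier)
  then have "det M = 0" using det_transpose[OF M] by simp
  then obtain x where x: "x \<in> carrier_vec p" "x \<noteq> 0\<^sub>v p" "M *\<^sub>v x = 0\<^sub>v p"
    using det_0_iff_vec_prod_zero[OF M] by blast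
  have "C *\<^sub>v x = 0\<^sub>v k"
  proof (rule eq_vecI)
    fix i assume "i < dim_vec (0\<^sub>v k :: complex vec)"
    then have i: "i < k" by simp
    then have "row M i = row C i" using assms by (auto simp: M_def)
    then show "(C *\<^sub>v x) $ i = 0\<^sub>v k $ i"
      using arg_cong[OF x(3), of "\<lambda>u. u $ i"] i assms M by auto
  qed (use C in auto)
  then show ?thesis using x by blast
qed

text \<open>The form of \<open>S\<close> is definite on the span of the columns of \<open>U\<close> indexed by \<open>I\<close> and vanishes on the
  kernel of \<open>B\<^sup>*\<close>. With more than \<open>k\<close> columns, the \<open>k\<close> equations \<open>B\<^sup>* v = 0\<close> would have a nontrivial
  solution in that span. The factor \<open>s\<close> lets one statement serve the positive and the negative
  eigenvalues.\<close>

lemma card_definite_directions_le: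
  fixes S U B :: "complex mat" and s :: real
  assumes S: "S \<in> carrier_mat n n" and U: "U \<in> carrier_mat n n" and B: "B \<in> carrier_mat n k"
    and diag: "mat_adjoint U * S * U = mat_diag n d"
    and iso: "\<And>v. v \<in> carrier_vec n \<Longrightarrow> mat_adjoint B *\<^sub>v v = 0\<^sub>v k \<Longrightarrow> (S *\<^sub>v v) \<bullet>c v = 0"
    and I: "I \<subseteq> {..<n}" and sign: "\<And>i. i \<in> I \<Longrightarrow> 0 < s * Re (d i)"
  shows "card I \<le> k"
proof (rule ccontr)
  define p where "p = card I"
  assume "\<not> card I \<le> k"
  then have kp: "k < p" unfolding p_def by simp
  have "finite I" using I finite_subset by blast
  then obtain h where h: "bij_betw h {0..<p} I" unfolding p_def using ex_bij_betw_nat_finite by blast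
  then have hI: "h j \<in> I" if "j < p" for j using that by (auto simp: bij_betw_def)
  then have hn: "h j < n" if "j < p" for j using that I by auto
  have hinj: "h a = h b \<longleftrightarrow> a = b" if "a < p" "b < p" for a b
    using h that by (auto simp: bij_betw_def inj_on_def)
  \<comment> \<open>the columns of \<open>U\<close> with index in \<open>I\<close>\<close>
  define V where "V = mat n p (\<lambda>(i,j). U $$ (i, h j))"
  have V: "V \<in> carrier_mat n p" unfolding V_def by simp
  have V': "mat_adjoint V \<in> carrier_mat p n" using V by (rule mat_adjoint_carrier)
  have U': "mat_adjoint U \<in> carrier_mat n n" using U by (rule mat_adjoint_carrier)
  have B': "mat_adjoint B \<in> carrier_mat k n" using B by (rule mat_adjoint_carrier)
  have compress: "mat_adjoint V * S * V = mat_diag p (\<lambda>j. d (h j))"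
  proof (rule eq_matI)
    fix a b
    assume "a < dim_row (mat_diag p (\<lambda>j. d (h j)))" "b < dim_col (mat_diag p (\<lambda>j. d (h j)))"
    then have ab: "a < p" "b < p" by (auto simp: mat_diag_def)
    have "col V b = col U (h b)" and "row (mat_adjoint V) a = row (mat_adjoint U) (h a)"
      using ab hn U V by (auto simp: V_def mat_adjoint_index)
    then have "(mat_adjoint V * S * V) $$ (a,b) = (mat_adjoint U * S * U) $$ (h a, h b)"
      unfolding assoc_mult_mat[OF V' S V] assoc_mult_mat[OF U' S U]
      using ab hn U V S by (simp add: col_mult2[OF S V] col_mult2[OF S U] del: row_mult)
    then show "(mat_adjoint V * S * V) $$ (a,b) = mat_diag p (\<lambda>j. d (h j)) $$ (a,b)"
      unfolding diag using ab hn hinj by (auto simp: mat_diag_def)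
  qed (use V in \<open>auto simp: mat_diag_def\<close>)
  obtain x where x: "x \<in> carrier_vec p" "x \<noteq> 0\<^sub>v p" "(mat_adjoint B * V) *\<^sub>v x = 0\<^sub>v k"
    using underdetermined_system[OF mult_carrier_mat[OF B' V] kp] by blast
  have "0 = (S *\<^sub>v (V *\<^sub>v x)) \<bullet>c (V *\<^sub>v x)"
    using iso[of "V *\<^sub>v x"] x V B' by (simp add: assoc_mult_mat_vec[of _ k n])
  also have "\<dots> = (mat_adjoint V *\<^sub>v (S *\<^sub>v (V *\<^sub>v x))) \<bullet>c x"
    using cscalar_prod_mult_adjoint[OF V', of "S *\<^sub>v (V *\<^sub>v x)" x] S V x
    by (simp add: mat_adjoint_adjoint)
  also have "mat_adjoint V *\<^sub>v (S *\<^sub>v (V *\<^sub>v x)) = (mat_adjoint V * S * V) *\<^sub>v x"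
    using V V' S x
    by (simp add: assoc_mult_mat_vec[OF mult_carrier_mat[OF V' S] V] assoc_mult_mat_vec[OF V' S]
        del: assoc_mult_mat)
  also have "\<dots> \<bullet>c x = (\<Sum>j<p. d (h j) * x $ j * cnj (x $ j))"
    unfolding compress using x
    by (auto simp: scalar_prod_def atLeast0LessThan mat_diag_def if_distrib[of "\<lambda>y. y * _"]
        sum.delta cong: if_cong intro!: sum.cong)
  finally have "0 = (\<Sum>j<p. d (h j) * of_real ((cmod (x $ j))\<^sup>2))"
    by (simp only: complex_norm_square mult.assoc)
  then have "0 = s * Re (\<Sum>j<p. d (h j) * of_real ((cmod (x $ j))\<^sup>2))" by simp
  also have "\<dots> = (\<Sum>j<p. s * Re (d (h j)) * (cmod (x $ j))\<^sup>2)"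
    by (simp add: sum_distrib_left mult.assoc del: of_real_power)
  finally have zero: "(\<Sum>j<p. s * Re (d (h j)) * (cmod (x $ j))\<^sup>2) = 0" by simp
  have "s * Re (d (h j)) * (cmod (x $ j))\<^sup>2 = 0" if "j < p" for j
    using zero that sign[OF hI] by (subst (asm) sum_nonneg_eq_0_iff) (auto simp: less_imp_le)
  then have "x $ j = 0" if "j < p" for j
    using that sign[OF hI[OF that]] by fastforce
  then show False using x(1,2) by (metis eq_vecI carrier_vecD index_zero_vec)
qed

text \<open>The form of \<open>S(A)\<close> at \<open>v\<close> is the imaginary part of \<open>v\<^sup>* A v\<close>, and \<open>v\<^sup>* H v\<close> is real.\<close>

lemma skew_part_form_vanishes:
  assumes A: "A \<in> carrier_mat n n" and H: "H \<in> carrier_mat n n" "hermitian_mat H"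
    and v: "v \<in> carrier_vec n" and Av: "A *\<^sub>v v = H *\<^sub>v v"
  shows "(skew_part A *\<^sub>v v) \<bullet>c v = 0"
proof -
  have A': "mat_adjoint A \<in> carrier_mat n n" using A by (rule mat_adjoint_carrier)
  have "(mat_adjoint A *\<^sub>v v) \<bullet>c v = v \<bullet>c (A *\<^sub>v v)"
    using cscalar_prod_mult_adjoint[OF A' v v] by (simp add: mat_adjoint_adjoint)
  also have "\<dots> = (H *\<^sub>v v) \<bullet>c v"
    using cscalar_prod_mult_adjoint[OF H(1) v v] H(2) Av by (simp add: hermitian_mat_def)
  also have "\<dots> = (A *\<^sub>v v) \<bullet>c v" using Av by simp
  finally have eq: "(mat_adjoint A *\<^sub>v v) \<bullet>c v = (A *\<^sub>v v) \<bullet>c v" .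
  have "A - mat_adjoint A \<in> carrier_mat n n" by (rule minus_carrier_mat[OF A'])
  then have "skew_part A *\<^sub>v v = (1 / (2 * \<i>)) \<cdot>\<^sub>v ((A - mat_adjoint A) *\<^sub>v v)"
    unfolding skew_part_def using v by (intro eq_vecI) auto
  also have "(A - mat_adjoint A) *\<^sub>v v = A *\<^sub>v v - mat_adjoint A *\<^sub>v v"
    by (rule minus_mult_distrib_mat_vec[OF A A' v])
  finally have "skew_part A *\<^sub>v v = (1 / (2 * \<i>)) \<cdot>\<^sub>v (A *\<^sub>v v - mat_adjoint A *\<^sub>v v)" .
  then have "(skew_part A *\<^sub>v v) \<bullet>c v =
      (1 / (2 * \<i>)) * ((A *\<^sub>v v) \<bullet>c v - (mat_adjoint A *\<^sub>v v) \<bullet>c v)"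
    using A A' v by (simp add: minus_scalar_prod_distrib[of _ n])
  then show ?thesis using eq by simp
qed

section \<open>Splitting off a low-rank term\<close>

text \<open>A nonnegative combination of the rank-one matrices \<open>u\<^sub>l u\<^sub>l\<^sup>*\<close>, where \<open>u\<^sub>l\<close> is the \<open>l\<close>-th column of
  \<open>U\<close>, is \<open>X X\<^sup>*\<close>: take the columns \<open>u\<^sub>l\<close> scaled by the square roots of the weights and fill up with
  zero columns.\<close>

lemma low_rank_square:
  fixes U :: "complex mat" and w :: "nat \<Rightarrow> real"
  assumes "finite I" "card I \<le> k" "\<And>l. l \<in> I \<Longrightarrow> 0 \<le> w l"
  shows "\<exists>X\<in>carrier_mat n k. \<forall>i<n. \<forall>j<n.
    (\<Sum>l<k. X $$ (i,l) * cnj (X $$ (j,l))) = (\<Sum>l\<in>I. of_real (w l) * U $$ (i,l) * cnj (U $$ (j,l)))"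
proof -
  obtain h where h: "bij_betw h {0..<card I} I" using ex_bij_betw_nat_finite[OF assms(1)] by blast
  define X where
    "X = mat n k (\<lambda>(i,l). if l < card I then of_real (sqrt (w (h l))) * U $$ (i, h l) else 0)"
  have "(\<Sum>l<k. X $$ (i,l) * cnj (X $$ (j,l))) = (\<Sum>l\<in>I. of_real (w l) * U $$ (i,l) * cnj (U $$ (j,l)))"
    if ij: "i < n" "j < n" for i j
  proof -
    have "(\<Sum>l<k. X $$ (i,l) * cnj (X $$ (j,l))) = (\<Sum>l\<in>{0..<card I}. X $$ (i,l) * cnj (X $$ (j,l)))"
      using assms(2) ij by (intro sum.mono_neutral_right) (auto simp: X_def)
    also have "\<dots> = (\<Sum>l\<in>{0..<card I}. of_real (w (h l)) * U $$ (i, h l) * cnj (U $$ (j, h l)))"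
    proof (rule sum.cong)
      fix l assume l: "l \<in> {0..<card I}"
      then have "h l \<in> I" using h by (auto simp: bij_betw_def)
      then have "of_real (sqrt (w (h l))) * of_real (sqrt (w (h l))) = (of_real (w (h l)) :: complex)"
        using assms(3) by (simp flip: of_real_mult)
      then show "X $$ (i,l) * cnj (X $$ (j,l)) =
          of_real (w (h l)) * U $$ (i, h l) * cnj (U $$ (j, h l))"
        using l assms(2) ij by (simp add: X_def)
    qed simp
    also have "\<dots> = (\<Sum>l\<in>I. of_real (w l) * U $$ (i,l) * cnj (U $$ (j,l)))"
      by (rule sum.reindex_bij_betw[OF h])
    finally show ?thesis .
  qed
  then show ?thesis by (intro bexI[of _ X]) (auto simp: X_def)
qed

text \<open>The choice \<open>G = \<i> (X + Y)\<close>, \<open>B = X - Y\<close> absorbs the positive and the negative part into the same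
  \<open>k\<close> columns; the mixed terms \<open>\<i> (Y X\<^sup>* - X Y\<^sup>*)\<close> that it produces are Hermitian and go into \<open>H\<close>.\<close>

lemma hermitian_plus_rank_if_skew_part_difference:
  assumes A: "A \<in> carrier_mat n n" and X: "X \<in> carrier_mat n k" and Y: "Y \<in> carrier_mat n k"
    and diff: "\<And>i j. i < n \<Longrightarrow> j < n \<Longrightarrow> skew_part A $$ (i,j) =
      (\<Sum>l<k. X $$ (i,l) * cnj (X $$ (j,l))) - (\<Sum>l<k. Y $$ (i,l) * cnj (Y $$ (j,l)))"
  shows "A \<in> hermitian_plus_rank n k"
proof -
  define G where "G = \<i> \<cdot>\<^sub>m (X + Y)"
  define B where "B = X - Y"
  define H where "H = A - G * mat_adjoint B"
  have G: "G \<in> carrier_mat n k" and B: "B \<in> carrier_mat n k" using X Y by (auto simp: G_def B_def)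
  have B': "mat_adjoint B \<in> carrier_mat k n" using B by (rule mat_adjoint_carrier)
  have H: "H \<in> carrier_mat n n" unfolding H_def
    by (rule minus_carrier_mat[OF mult_carrier_mat[OF G B']])
  have entry: "H $$ (i,j) = A $$ (i,j) - (\<Sum>l<k. \<i> * (X $$ (i,l) + Y $$ (i,l)) * cnj (X $$ (j,l) - Y $$ (j,l)))"
    if "i < n" "j < n" for i j
    using that A X Y unfolding H_def G_def B_def
    by (auto simp: scalar_prod_def mat_adjoint_index atLeast0LessThan)
  have skew: "A $$ (i,j) - cnj (A $$ (j,i)) = 2 * \<i> * skew_part A $$ (i,j)" if "i < n" "j < n" for i j
    using that A by (simp add: skew_part_def mat_adjoint_index)
  have "cnj (H $$ (j,i)) = H $$ (i,j)" if ij: "i < n" "j < n" for i j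
  proof -
    have "H $$ (i,j) - cnj (H $$ (j,i)) = (A $$ (i,j) - cnj (A $$ (j,i)))
        - (\<Sum>l<k. \<i> * (X $$ (i,l) + Y $$ (i,l)) * cnj (X $$ (j,l) - Y $$ (j,l))
          - cnj (\<i> * (X $$ (j,l) + Y $$ (j,l)) * cnj (X $$ (i,l) - Y $$ (i,l))))"
      unfolding entry[OF ij] entry[OF ij(2,1)] sum_subtractf by (simp only: complex_cnj_diff cnj_sum)
        (simp only: algebra_simps)
    also have "(\<Sum>l<k. \<i> * (X $$ (i,l) + Y $$ (i,l)) * cnj (X $$ (j,l) - Y $$ (j,l))
          - cnj (\<i> * (X $$ (j,l) + Y $$ (j,l)) * cnj (X $$ (i,l) - Y $$ (i,l))))
        = (\<Sum>l<k. 2 * \<i> * (X $$ (i,l) * cnj (X $$ (j,l)) - Y $$ (i,l) * cnj (Y $$ (j,l))))"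
      by (rule sum.cong) (auto simp: algebra_simps)
    also have "\<dots> = 2 * \<i> * skew_part A $$ (i,j)"
      unfolding diff[OF ij] by (simp only: sum_distrib_left sum_subtractf right_diff_distrib)
    finally show ?thesis using skew[OF ij] by simp
  qed
  then have "hermitian_mat H"
    unfolding hermitian_mat_def using H by (intro eq_matI) (auto simp: mat_adjoint_index)
  moreover have "A = H + G * mat_adjoint B"
    unfolding H_def using A G B' by (intro eq_matI) auto
  ultimately show ?thesis unfolding hermitian_plus_rank_def using H G B by blast
qed

theorem theorem12:
  fixes A :: "complex mat" and n k :: nat
  assumes "A \<in> carrier_mat n n"
    and "k \<le> n"
  shows "A \<in> hermitian_plus_rank n k \<longleftrightarrow>
           num_pos_eigenvalues (skew_part A) \<le> k \<and> num_neg_eigenvalues (skew_part A) \<le> k"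
proof -
  define S where "S = skew_part A"
  have S: "S \<in> carrier_mat n n"
    unfolding S_def skew_part_def
    by (intro smult_carrier_mat minus_carrier_mat mat_adjoint_carrier assms(1))
  have herm: "hermitian_mat S" unfolding S_def using assms(1) by (rule hermitian_skew_part)
  obtain es where es: "char_poly S = (\<Prod>a\<leftarrow>es. [:- a, 1:])" "length es = n"
    using char_poly_factorized[OF S] by blast
  obtain U where U: "U \<in> carrier_mat n n" and UU: "mat_adjoint U * U = 1\<^sub>m n"
    and diag: "mat_adjoint U * S * U = mat_diag n (\<lambda>i. es ! i)"
    using hermitian_spectral_theorem[OF S herm es(1)] by blast
  define P where "P = {i. i < n \<and> es ! i \<in> \<real> \<and> 0 < Re (es ! i)}"
  define N where "N = {i. i < n \<and> es ! i \<in> \<real> \<and> Re (es ! i) < 0}"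
  have count: "num_pos_eigenvalues S = card P" "num_neg_eigenvalues S = card N"
    using num_eigenvalues_eq_card[OF es(1)] unfolding P_def N_def es(2) .
  have "A \<in> hermitian_plus_rank n k \<longleftrightarrow> card P \<le> k \<and> card N \<le> k"
  proof
    assume "A \<in> hermitian_plus_rank n k"
    then obtain H G B where H: "H \<in> carrier_mat n n" "hermitian_mat H"
      and G: "G \<in> carrier_mat n k" and B: "B \<in> carrier_mat n k" and A: "A = H + G * mat_adjoint B"
      unfolding hermitian_plus_rank_def by blast
    have B': "mat_adjoint B \<in> carrier_mat k n" using B by (rule mat_adjoint_carrier)
    have iso: "(S *\<^sub>v v) \<bullet>c v = 0" if v: "v \<in> carrier_vec n" and Bv: "mat_adjoint B *\<^sub>v v = 0\<^sub>v k" for v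
    proof -
      have "G *\<^sub>v 0\<^sub>v k = 0\<^sub>v n" using G by (intro eq_vecI) auto
      then have "A *\<^sub>v v = H *\<^sub>v v"
        unfolding A using H G B' v Bv
        by (simp add: add_mult_distrib_mat_vec[of _ n n] assoc_mult_mat_vec[of _ n k])
      then show ?thesis unfolding S_def using skew_part_form_vanishes[OF assms(1) H v] by simp
    qed
    have "card P \<le> k"
      by (rule card_definite_directions_le[OF S U B diag iso, where s = 1]) (auto simp: P_def)
    moreover have "card N \<le> k"
      by (rule card_definite_directions_le[OF S U B diag iso, where s = "- 1"]) (auto simp: N_def)
    ultimately show "card P \<le> k \<and> card N \<le> k" ..
  next
    assume card: "card P \<le> k \<and> card N \<le> k"
    have real: "es ! i \<in> \<real>" if "i < n" for i
      using hermitian_compression_diag_real[OF S herm U diag that] .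
    obtain X where X: "X \<in> carrier_mat n k" "\<And>i j. i < n \<Longrightarrow> j < n \<Longrightarrow>
        (\<Sum>l<k. X $$ (i,l) * cnj (X $$ (j,l)))
        = (\<Sum>l\<in>P. of_real (Re (es ! l)) * U $$ (i,l) * cnj (U $$ (j,l)))"
      using low_rank_square[of P k "\<lambda>l. Re (es ! l)" n U] card by (auto simp: P_def)
    obtain Y where Y: "Y \<in> carrier_mat n k" "\<And>i j. i < n \<Longrightarrow> j < n \<Longrightarrow>
        (\<Sum>l<k. Y $$ (i,l) * cnj (Y $$ (j,l)))
        = (\<Sum>l\<in>N. of_real (- Re (es ! l)) * U $$ (i,l) * cnj (U $$ (j,l)))"
      using low_rank_square[of N k "\<lambda>l. - Re (es ! l)" n U] card by (auto simp: N_def)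
    show "A \<in> hermitian_plus_rank n k"
    proof (rule hermitian_plus_rank_if_skew_part_difference[OF assms(1) X(1) Y(1)])
      fix i j assume ij: "i < n" "j < n"
      let ?t = "\<lambda>l. es ! l * U $$ (i,l) * cnj (U $$ (j,l))"
      have "skew_part A $$ (i,j) = (\<Sum>l<n. ?t l)"
        using spectral_entry[OF S U UU diag ij] unfolding S_def .
      also have "\<dots> = (\<Sum>l\<in>P \<union> N. ?t l)"
      proof (rule sum.mono_neutral_right)
        have "es ! l = 0" if "l \<in> {..<n} - (P \<union> N)" for l
          using that real[of l]
          by (intro complex_eqI) (auto simp: P_def N_def complex_is_Real_iff)
        then show "\<forall>l\<in>{..<n} - (P \<union> N). ?t l = 0" by simp
      qed (auto simp: P_def N_def)
      also have "\<dots> = (\<Sum>l\<in>P. ?t l) + (\<Sum>l\<in>N. ?t l)"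
        by (rule sum.union_disjoint) (auto simp: P_def N_def)
      also have "(\<Sum>l\<in>P. ?t l) = (\<Sum>l\<in>P. of_real (Re (es ! l)) * U $$ (i,l) * cnj (U $$ (j,l)))"
        by (rule sum.cong) (auto simp: P_def)
      also have "(\<Sum>l\<in>N. ?t l) = - (\<Sum>l\<in>N. of_real (- Re (es ! l)) * U $$ (i,l) * cnj (U $$ (j,l)))"
        by (auto simp: N_def simp flip: sum_negf intro!: sum.cong)
      finally show "skew_part A $$ (i,j) =
          (\<Sum>l<k. X $$ (i,l) * cnj (X $$ (j,l))) - (\<Sum>l<k. Y $$ (i,l) * cnj (Y $$ (j,l)))"
        unfolding X(2)[OF ij] Y(2)[OF ij] by simp
    qed
  qed
  then show ?thesis unfolding count[folded S_def, symmetric] S_def .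
qed

end
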